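(* Let $(X,d)$ be a metric space, $Y$ a real vector space, $K\subset Y$ a pointed convex cone specifying a partial order $\le_K$ on $Y$, and $H\subset K$ a nonempty $K$-convex set with $0\notin\mathrm{vcl}(H+K)$. Put $C_H:=H+K$. Let $f:X\to 2^Y$ be a set-valued map, $S$ a nonempty closed subset of $X$, $x_0\in S$, $\epsilon>0$, and let $\gamma>0$ be a constant. For any $x\in S$, put $$S(x):=\{x'\in S:\ f(x)\subset f(x')+\gamma\, d(x,x')H+K\}.$$ Suppose that the following conditions are satisfied: (i) $(X,d)$ is $S(x_0)$-dynamically complete or $(X,d)$ is $(f,K)$-lower complete; (ii) $x_0\in AE(C_H,\epsilon)$, i.e., $f(x_0)\not\subset f(S)+\epsilon H+K$; (iii) for any $x\in S(x_0)$, $S(x)$ is dynamically closed. Then there exists $\bar x\in S$ such that (a) $f(x_0)\subset f(\bar x)+\gamma\, d(x_0,\bar x)H+K$; (b) $\bar x$ is a strict minimizer of the set-valued map $x\mapsto f(x)+\gamma\, d(\bar x,x)H$, i.e., $f(\bar x)\not\subset f(x)+\gamma\, d(\bar x,x)H+K$ for all $x\in S\setminus\{\bar x\}$; (c) $d(x_0,\bar x)H\cap(\epsilon/\gamma)\big(\mathrm{cone}(C_H)\setminus C_H\big)\ne\emptyset$.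
   Context: $2^Y$ is the family of all subsets of $Y$; for $A\subset X$, $f(A)=\bigcup_{x\in A}f(x)$. For $A,B\subset Y$ and $\alpha\in\mathbb R$, $A+B=\{a+b:a\in A,b\in B\}$ and $\alpha A=\{\alpha a:a\in A\}$. A cone is a nonempty set $K\subset Y$ with $\alpha K\subset K$ for all $\alpha\ge 0$; it is a convex cone if also $K+K\subset K$, and pointed if $K\cap(-K)=\{0\}$. Cones are always assumed nontrivial: $K\ne\{0\}$ and $K\ne Y$. The order is $y_1\le_K y_2\iff y_1-y_2\in -K$. A set $H$ is $K$-convex if $H+K$ is convex. $\mathrm{cone}(C)=\{\alpha c:\alpha\ge 0,\ c\in C\}$. For nonempty $A\subset Y$, the vector closure is $\mathrm{vcl}(A)=\{y\in Y:\exists v\in Y,\ \exists \lambda_n\ge 0,\ \lambda_n\to 0 \text{ with } y+\lambda_n v\in A\ \forall n\in\mathbb N\}$. $x_0\in AE(C_H,\epsilon)$ ($x_0$ is an $\epsilon$-efficient solution, in the sense of Németh with respect to $H$, of the problem of minimizing $f$ over $S$) means: $x_0\in S$ and there exists $y_0\in f(x_0)$ with $(f(S)-y_0)\cap(-\epsilon H-K)=\emptyset$. $S(x)$ is dynamically closed if whenever $(x_n)\subset S(x)$ is a sequence with $x_{n+1}\in S(x_n)$ for all $n$ and $x_n\to\bar x$, then $\bar x\in S(x)$. $(X,d)$ is $S(x)$-dynamically complete if for any Cauchy sequence $(x_n)\subset S(x)$ with $x_{n+1}\in S(x_n)$ for all $n$, there exists $\bar x\in X$ with $x_n\to\bar x$.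 $(X,d)$ is $(f,K)$-lower complete if every Cauchy sequence $(x_n)\subset X$ with $f(x_n)\subset f(x_{n+1})+K$ for all $n$ converges to some point of $X$. *)

theory Defs
  imports "HOL-Analysis.Analysis"
begin

text \<open>
  The metric space X is the type \<open>'a::metric_space\<close>, the real vector space Y is the type
  \<open>'b::real_vector\<close> (no topology on Y is assumed), and a set-valued map is a function
  \<open>'a \<Rightarrow> 'b set\<close>.  Empty values are allowed.
  Sums of sets are Minkowski sums, from \<^theory>\<open>HOL-Library.Set_Algebras\<close>; \<open>(*\<^sub>R) c ` A\<close> is the multiple
  of A by c, so that it is \<open>{0}\<close> when \<open>c = 0\<close> and A is nonempty.  On sets, the signs \<open>-\<close> mean
  complement and set difference, so the reflection of A is written \<open>uminus ` A\<close>.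
\<close>

text \<open>
  The library's \<open>convex_cone\<close> requires a nonempty set closed under multiplication by nonnegative
  scalars; given this, its convexity requirement amounts to \<open>K + K \<subseteq> K\<close> (see \<open>convex_cone_iff\<close>).
\<close>
definition nontrivial_pointed_convex_cone :: "'b::real_vector set \<Rightarrow> bool" where
  "nontrivial_pointed_convex_cone K \<longleftrightarrow>
     convex_cone K \<and> K \<inter> uminus ` K = {0} \<and> K \<noteq> {0} \<and> K \<noteq> UNIV"

definition cone_convex :: "'b::real_vector set \<Rightarrow> 'b set \<Rightarrow> bool" where
  "cone_convex K H \<longleftrightarrow> convex (H + K)"

definition generated_cone :: "'b::real_vector set \<Rightarrow> 'b set" where
  "generated_cone C = {\<alpha> *\<^sub>R c |\<alpha> c. \<alpha> \<ge> 0 \<and> c \<in> C}"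

definition vcl :: "'b::real_vector set \<Rightarrow> 'b set" where
  "vcl A = {y. \<exists>v. \<exists>l :: nat \<Rightarrow> real.
     (\<forall>n. l n \<ge> 0) \<and> l \<longlonglongrightarrow> 0 \<and> (\<forall>n. y + l n *\<^sub>R v \<in> A)}"

text \<open>
  The \<open>\<epsilon>\<close>-efficient solutions, in the sense of Nemeth with respect to H, of minimizing f over S.
  The two sets whose intersection is taken are \<open>f(S) - y\<^sub>0\<close> and \<open>- \<epsilon>H - K\<close>.
\<close>
definition eps_efficient :: "('a \<Rightarrow> 'b::real_vector set) \<Rightarrow> 'a set \<Rightarrow> 'b set \<Rightarrow> 'b set \<Rightarrow> real \<Rightarrow> 'a set" where
  "eps_efficient f S H K \<epsilon> = {x\<^sub>0 \<in> S. \<exists>y\<^sub>0\<in>f x\<^sub>0.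
     (\<lambda>y. y - y\<^sub>0) ` (\<Union>x\<in>S. f x) \<inter> ((*\<^sub>R) (- \<epsilon>) ` H + uminus ` K) = {}}"

definition level_set ::
  "('a::metric_space \<Rightarrow> 'b::real_vector set) \<Rightarrow> 'a set \<Rightarrow> 'b set \<Rightarrow> 'b set \<Rightarrow> real \<Rightarrow> 'a \<Rightarrow> 'a set"
where
  "level_set f S H K \<gamma> x = {x'\<in>S. f x \<subseteq> f x' + (*\<^sub>R) (\<gamma> * dist x x') ` H + K}"

definition dynamically_closed :: "('a::metric_space \<Rightarrow> 'a set) \<Rightarrow> 'a \<Rightarrow> bool" where
  "dynamically_closed T x \<longleftrightarrow>
     (\<forall>u l. (\<forall>n. u n \<in> T x) \<longrightarrow> (\<forall>n. u (Suc n) \<in> T (u n)) \<longrightarrow> u \<longlonglongrightarrow> l \<longrightarrow> l \<in> T x)"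

definition dynamically_complete :: "('a::metric_space \<Rightarrow> 'a set) \<Rightarrow> 'a \<Rightarrow> bool" where
  "dynamically_complete T x \<longleftrightarrow>
     (\<forall>u. Cauchy u \<longrightarrow> (\<forall>n. u n \<in> T x) \<longrightarrow> (\<forall>n. u (Suc n) \<in> T (u n)) \<longrightarrow> (\<exists>l. u \<longlonglongrightarrow> l))"

definition lower_complete :: "('a::metric_space \<Rightarrow> 'b::real_vector set) \<Rightarrow> 'b set \<Rightarrow> bool" where
  "lower_complete f K \<longleftrightarrow>
     (\<forall>u. Cauchy u \<longrightarrow> (\<forall>n. f (u n) \<subseteq> f (u (Suc n)) + K) \<longrightarrow> (\<exists>l. u \<longlonglongrightarrow> l))"

end

theory Submission
  imports Defs
begin

text \<open>
  Write \<open>C a\<close> for the set \<open>a H + K\<close>.  Because \<open>H + K\<close> is convex and H lies in the convex cone K,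
  these sets satisfy \<open>C a + C b \<subseteq> C (a + b)\<close> for \<open>a, b \<ge> 0\<close>, and \<open>C b \<subseteq> C a\<close> for \<open>0 \<le> a \<le> b\<close>
  (\<open>scaled_add_cone_plus\<close>, \<open>scaled_add_cone_antimono\<close>).  Combined with the triangle
  inequality, these make the relation \<open>x' \<in> S(x)\<close> a preorder on S (\<open>level_set_refl\<close>,
  \<open>level_set_trans\<close>), and they let lengths accumulate along a chain
  \<open>x\<^sub>0, x\<^sub>1, \<dots>\<close> with \<open>x\<^sub>n\<^sub>+\<^sub>1 \<in> S(x\<^sub>n)\<close>: every \<open>y \<in> f(x\<^sub>0)\<close> lies in \<open>f(x\<^sub>n) + C (\<gamma> L\<^sub>n)\<close>, where \<open>L\<^sub>n\<close>
  is the length of the chain up to \<open>x\<^sub>n\<close>.  Approximate efficiency provides a value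
  \<open>y\<^sub>0 \<in> f(x\<^sub>0)\<close> that no \<open>f(x) + C \<epsilon>\<close> with \<open>x \<in> S\<close> contains, hence \<open>\<gamma> L\<^sub>n < \<epsilon>\<close>: all chains
  from \<open>x\<^sub>0\<close> have uniformly bounded length.

  A preorder with this property, whose Cauchy chains converge and whose sections are closed along
  chains, has a point \<open>z \<in> S(x\<^sub>0)\<close> with \<open>S(z) \<subseteq> {z}\<close>.  This is the principle of Dancs, Hegedus
  and Medvegyev, \<open>bounded_chains_imp_minimal\<close>: a chain that always moves at least half as far
  as possible must end up with no room to move.  The point z satisfies (a) because
  \<open>z \<in> S(x\<^sub>0)\<close>, and (b) because \<open>S(z) \<subseteq> {z}\<close>.

  For (c), the factor \<open>t = \<gamma> d(x\<^sub>0,z) / \<epsilon>\<close> is less than 1.  If \<open>t H\<close> were contained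
  in \<open>H + K\<close>, then iteration would put \<open>t\<^sup>n h\<close> in \<open>H + K\<close> for all n, which would make 0 a point of
  the vector closure of \<open>H + K\<close>.  So some \<open>t h\<close> lies outside \<open>H + K\<close>
  (\<open>contraction_leaves_add_cone\<close>), and \<open>d(x\<^sub>0,z) h = (\<epsilon>/\<gamma>) t h\<close> is a common point of
  the two sets in (c).
\<close>

section \<open>Minimal points of preorders with chains of bounded length\<close>

text \<open>
  The bound on the length of chains serves twice: it makes the greedy chain Cauchy, and it makes
  the sections \<open>T x\<close> bounded, so that moving half as far as possible makes sense.
\<close>
lemma bounded_chains_imp_minimal:
  fixes T :: "'a::metric_space \<Rightarrow> 'a set"
  assumes refl: "x\<^sub>0 \<in> T x\<^sub>0"
    and trans: "\<And>x y z. y \<in> T x \<Longrightarrow> z \<in> T y \<Longrightarrow> z \<in> T x"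
    and bounded: "\<And>u n. u 0 = x\<^sub>0 \<Longrightarrow> (\<And>n. u (Suc n) \<in> T (u n)) \<Longrightarrow>
           (\<Sum>k<n. dist (u k) (u (Suc k))) \<le> B"
    and refl': "\<And>x. x \<in> T x\<^sub>0 \<Longrightarrow> x \<in> T x"
    and complete: "dynamically_complete T x\<^sub>0"
    and closed: "\<And>x. x \<in> T x\<^sub>0 \<Longrightarrow> dynamically_closed T x"
  shows "\<exists>z\<in>T x\<^sub>0. T z \<subseteq> {z}"
proof -
  have near: "dist x\<^sub>0 x \<le> B" if "x \<in> T x\<^sub>0" for x
  proof -
    define u where "u n = (if n = 0 then x\<^sub>0 else x)" for n :: nat
    show ?thesis
      using bounded[of u 1] that refl'[OF that] by (simp add: u_def)
  qed
  define R where "R x = (SUP x'\<in>T x. dist x x')" for x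
  have bdd: "bdd_above (dist x ` T x)" if "x \<in> T x\<^sub>0" for x
  proof (rule bdd_aboveI2)
    fix x' assume "x' \<in> T x"
    then have "x' \<in> T x\<^sub>0"
      using trans that by blast
    then show "dist x x' \<le> 2 * B"
      using near[OF that] near[of x'] dist_triangle3[of x x' x\<^sub>0] by simp
  qed
  have le_R: "dist x x' \<le> R x" if "x \<in> T x\<^sub>0" "x' \<in> T x" for x x'
    unfolding R_def using that(2) bdd[OF that(1)] by (rule cSUP_upper)
  have step: "\<exists>x'\<in>T x. R x / 2 \<le> dist x x'" if x: "x \<in> T x\<^sub>0" for x
  proof (cases "R x \<le> 0")
    case True
    then show ?thesis
      using refl'[OF x] by (intro bexI[of _ x]) auto
  next
    case False
    then have "R x / 2 < R x"
      by simp
    then obtain x' where "x' \<in> T x" "R x / 2 < dist x x'"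
      unfolding R_def using less_cSUP_iff[OF _ bdd[OF x]] refl'[OF x] by (metis empty_iff)
    then show ?thesis
      by (intro bexI[of _ x']) auto
  qed
  have "\<exists>u. \<forall>n. (u n \<in> T x\<^sub>0 \<and> (n = 0 \<longrightarrow> u n = x\<^sub>0)) \<and>
          (u (Suc n) \<in> T (u n) \<and> R (u n) / 2 \<le> dist (u n) (u (Suc n)))"
    by (rule dependent_nat_choice) (use refl step trans in blast)+
  then obtain u where u0: "u 0 = x\<^sub>0" and u_in: "\<And>n. u n \<in> T x\<^sub>0"
    and chain: "\<And>n. u (Suc n) \<in> T (u n)"
    and far: "\<And>n. R (u n) / 2 \<le> dist (u n) (u (Suc n))"
    by blast
  have summable: "summable (\<lambda>n. dist (u n) (u (Suc n)))"
  proof (rule bounded_imp_summable)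
    show "(\<Sum>k\<le>n. dist (u k) (u (Suc k))) \<le> B" for n
      unfolding lessThan_Suc_atMost[symmetric] using u0 chain by (rule bounded)
  qed simp
  have "Cauchy u"
  proof (rule metric_CauchyI)
    fix e :: real assume "e > 0"
    with summable obtain N
      where N: "\<And>m n. m \<ge> N \<Longrightarrow> norm (\<Sum>k=m..<n. dist (u k) (u (Suc k))) < e"
      unfolding summable_Cauchy by blast
    have "dist (u m) (u n) < e" if "N \<le> m" "m \<le> n" for m n
    proof -
      have "dist (u m) (u n) \<le> (\<Sum>k=m..<n. dist (u k) (u (Suc k)))"
        using that(2)
      proof (induction n rule: dec_induct)
        case (step n)
        then show ?case
          using dist_triangle[of "u m" "u (Suc n)" "u n"] by simp
      qed simp
      then show ?thesis
        using N[OF that(1), of n] by simp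
    qed
    then have "\<forall>m\<ge>N. \<forall>n\<ge>N. dist (u m) (u n) < e"
      by (metis dist_commute linear)
    then show "\<exists>N. \<forall>m\<ge>N. \<forall>n\<ge>N. dist (u m) (u n) < e" ..
  qed
  then obtain z where lim: "u \<longlonglongrightarrow> z"
    using complete u_in chain unfolding dynamically_complete_def by blast
  have z_in: "z \<in> T (u n)" for n
  proof -
    have "u (k + n) \<in> T (u n)" for k
      by (induction k) (use refl'[OF u_in] chain trans in auto)
    moreover have "(\<lambda>k. u (k + n)) \<longlonglongrightarrow> z"
      using lim by (rule LIMSEQ_ignore_initial_segment)
    ultimately show ?thesis
      using closed[OF u_in[of n]] chain unfolding dynamically_closed_def
      by (auto dest!: spec[of _ "\<lambda>k. u (k + n)"])
  qed
  have "x = z" if "x \<in> T z" for x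
  proof -
    \<comment> \<open>\<open>x\<close> stays within reach from every \<open>u n\<close>, and the reach shrinks to 0 along the chain.\<close>
    have "dist (u n) x \<le> 2 * dist (u n) (u (Suc n))" for n
      using le_R[OF u_in trans[OF z_in that], of n] far[of n] by simp
    moreover have "(\<lambda>n. 2 * dist (u n) (u (Suc n))) \<longlonglongrightarrow> 0"
      using tendsto_mult_right_zero[OF summable_LIMSEQ_zero[OF summable]] by blast
    ultimately have "(\<lambda>n. dist (u n) x) \<longlonglongrightarrow> 0"
      by (intro Lim_null_comparison[of "\<lambda>n. dist (u n) x" "\<lambda>n. 2 * dist (u n) (u (Suc n))"])
        simp_all
    then have "u \<longlonglongrightarrow> x"
      by (simp add: tendsto_dist_iff[of u])
    then show "x = z"
      using lim LIMSEQ_unique by blast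
  qed
  then show ?thesis
    using z_in[of 0] u0 by auto
qed

section \<open>The sets aH + K\<close>

lemma convex_cone_scaleR_mem:
  "convex_cone K \<Longrightarrow> x \<in> K \<Longrightarrow> 0 \<le> c \<Longrightarrow> c *\<^sub>R x \<in> K"
  by (simp add: convex_cone_iff)

lemma convex_cone_add_mem:
  "convex_cone K \<Longrightarrow> x \<in> K \<Longrightarrow> y \<in> K \<Longrightarrow> x + y \<in> K"
  by (simp add: convex_cone_iff)

lemma subset_add_cone:
  "convex_cone K \<Longrightarrow> H \<subseteq> H + K"
  using set_zero_plus2[of K H] convex_cone_contains_0[of K] by (simp add: add.commute)

lemma scaled_add_cone_antimono:
  fixes K H :: "'b::real_vector set"
  assumes K: "convex_cone K" and H: "H \<subseteq> K" and ab: "0 \<le> a" "a \<le> b"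
  shows "(*\<^sub>R) b ` H + K \<subseteq> (*\<^sub>R) a ` H + K"
proof
  fix y assume "y \<in> (*\<^sub>R) b ` H + K"
  then obtain h k where hk: "h \<in> H" "k \<in> K" "y = b *\<^sub>R h + k"
    by (auto simp: set_plus_def)
  have "y = a *\<^sub>R h + ((b - a) *\<^sub>R h + k)"
    using hk by (simp add: algebra_simps)
  moreover have "(b - a) *\<^sub>R h + k \<in> K"
    using hk H ab by (intro convex_cone_add_mem[OF K] convex_cone_scaleR_mem[OF K]) auto
  ultimately show "y \<in> (*\<^sub>R) a ` H + K"
    using hk by blast
qed

text \<open>
  When \<open>a + b > 0\<close>, the point \<open>a h\<^sub>1 + b h\<^sub>2\<close> is \<open>a + b\<close> times a convex combination of
  \<open>h\<^sub>1\<close> and \<open>h\<^sub>2\<close>; the latter need not be in H, but it is in the convex set \<open>H + K\<close>.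
\<close>
lemma scaled_add_cone_plus:
  fixes K H :: "'b::real_vector set"
  assumes K: "convex_cone K" and conv: "convex (H + K)" and ab: "0 \<le> a" "0 \<le> b"
  shows "((*\<^sub>R) a ` H + K) + ((*\<^sub>R) b ` H + K) \<subseteq> (*\<^sub>R) (a + b) ` H + K"
proof
  fix y assume "y \<in> ((*\<^sub>R) a ` H + K) + ((*\<^sub>R) b ` H + K)"
  then obtain h1 k1 h2 k2 where hk: "h1 \<in> H" "k1 \<in> K" "h2 \<in> H" "k2 \<in> K"
    and y: "y = (a *\<^sub>R h1 + k1) + (b *\<^sub>R h2 + k2)"
    by (auto simp: set_plus_def)
  have kk: "k1 + k2 \<in> K"
    using hk by (intro convex_cone_add_mem[OF K])
  show "y \<in> (*\<^sub>R) (a + b) ` H + K"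
  proof (cases "a + b = 0")
    case True
    then have "a = 0" "b = 0"
      using ab by auto
    then have "y = (a + b) *\<^sub>R h1 + (k1 + k2)"
      by (simp add: y)
    then show ?thesis
      using hk kk by blast
  next
    case False
    then have pos: "a + b > 0"
      using ab by auto
    have "(a / (a + b)) *\<^sub>R h1 + (b / (a + b)) *\<^sub>R h2 \<in> H + K"
      using hk ab pos subset_add_cone[OF K, of H]
      by (intro convexD[OF conv]) (auto simp: add_divide_distrib[symmetric])
    then obtain h k where h: "h \<in> H" "k \<in> K"
      "(a / (a + b)) *\<^sub>R h1 + (b / (a + b)) *\<^sub>R h2 = h + k"
      by (auto simp: set_plus_def)
    have "a *\<^sub>R h1 + b *\<^sub>R h2 = (a + b) *\<^sub>R ((a / (a + b)) *\<^sub>R h1 + (b / (a + b)) *\<^sub>R h2)"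
      using False by (simp add: scaleR_add_right)
    then have "y = (a + b) *\<^sub>R h + ((a + b) *\<^sub>R k + (k1 + k2))"
      unfolding h(3) y by (simp add: algebra_simps)
    moreover have "(a + b) *\<^sub>R k + (k1 + k2) \<in> K"
      using h pos by (intro convex_cone_add_mem[OF K _ kk] convex_cone_scaleR_mem[OF K]) auto
    ultimately show ?thesis
      using h(1) by blast
  qed
qed

text \<open>
  If no such h existed, then \<open>t H \<subseteq> H + K\<close> would iterate to \<open>t\<^sup>n h \<in> H + K\<close> for every n; along the
  direction h these points exhibit 0 as a member of the vector closure.
\<close>
lemma contraction_leaves_add_cone:
  fixes K H :: "'b::real_vector set"
  assumes K: "convex_cone K" and "H \<noteq> {}" and vcl: "0 \<notin> vcl (H + K)"
    and t: "0 \<le> t" "t < 1"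
  shows "\<exists>h\<in>H. t *\<^sub>R h \<notin> H + K"
proof (rule ccontr)
  assume "\<not> ?thesis"
  then have stay: "t *\<^sub>R h \<in> H + K" if "h \<in> H" for h
    using that by blast
  obtain h where h: "h \<in> H"
    using \<open>H \<noteq> {}\<close> by blast
  have "t ^ n *\<^sub>R h \<in> H + K" for n
  proof (induction n)
    case 0
    then show ?case
      using h subset_add_cone[OF K, of H] by auto
  next
    case (Suc n)
    then obtain h' k where hk: "h' \<in> H" "k \<in> K" "t ^ n *\<^sub>R h = h' + k"
      by (auto simp: set_plus_def)
    obtain h'' k' where hk': "h'' \<in> H" "k' \<in> K" "t *\<^sub>R h' = h'' + k'"
      using stay[OF hk(1)] by (auto simp: set_plus_def)
    have "t ^ Suc n *\<^sub>R h = t *\<^sub>R (h' + k)"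
      by (simp flip: hk(3))
    also have "\<dots> = h'' + (k' + t *\<^sub>R k)"
      by (simp add: hk'(3) algebra_simps)
    finally have "t ^ Suc n *\<^sub>R h = h'' + (k' + t *\<^sub>R k)" .
    moreover have "k' + t *\<^sub>R k \<in> K"
      using hk hk' t by (intro convex_cone_add_mem[OF K] convex_cone_scaleR_mem[OF K])
    ultimately show ?case
      using hk'(1) by auto
  qed
  then have "0 \<in> vcl (H + K)"
    unfolding vcl_def using t LIMSEQ_realpow_zero[OF t]
    by (intro CollectI exI[of _ h] exI[of _ "\<lambda>n. t ^ n"]) simp
  with vcl show False ..
qed

section \<open>The level-set preorder\<close>

lemma level_set_iff:
  "x' \<in> level_set f S H K \<gamma> x \<longleftrightarrow>
     x' \<in> S \<and> f x \<subseteq> f x' + ((*\<^sub>R) (\<gamma> * dist x x') ` H + K)"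
  by (simp add: level_set_def add.assoc)

lemma level_set_refl:
  assumes K: "convex_cone K" and "H \<noteq> {}" and "x \<in> S"
  shows "x \<in> level_set f S H K \<gamma> x"
proof -
  have "0 \<in> (*\<^sub>R) 0 ` H + K"
    using \<open>H \<noteq> {}\<close> convex_cone_contains_0[of K] K by (auto simp: image_constant_conv)
  then have "f x \<subseteq> f x + ((*\<^sub>R) 0 ` H + K)"
    using set_zero_plus2[of "(*\<^sub>R) 0 ` H + K" "f x"] by (simp add: add.commute)
  with \<open>x \<in> S\<close> show ?thesis
    by (simp add: level_set_iff)
qed

lemma level_set_trans:
  fixes f :: "'a::metric_space \<Rightarrow> 'b::real_vector set"
  assumes K: "convex_cone K" and H: "H \<subseteq> K" and conv: "convex (H + K)" and \<gamma>: "0 \<le> \<gamma>"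
    and y: "y \<in> level_set f S H K \<gamma> x" and z: "z \<in> level_set f S H K \<gamma> y"
  shows "z \<in> level_set f S H K \<gamma> x"
proof -
  let ?C = "\<lambda>a. (*\<^sub>R) a ` H + K"
  have "f x \<subseteq> f y + ?C (\<gamma> * dist x y)"
    using y by (simp add: level_set_iff)
  also have "\<dots> \<subseteq> (f z + ?C (\<gamma> * dist y z)) + ?C (\<gamma> * dist x y)"
    using z by (intro set_plus_mono2) (simp_all add: level_set_iff)
  also have "\<dots> = f z + (?C (\<gamma> * dist y z) + ?C (\<gamma> * dist x y))"
    by (rule add.assoc)
  also have "\<dots> \<subseteq> f z + ?C (\<gamma> * dist y z + \<gamma> * dist x y)"
    using \<gamma> by (intro set_plus_mono2 scaled_add_cone_plus[OF K conv]) auto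
  also have "\<dots> \<subseteq> f z + ?C (\<gamma> * dist x z)"
    using \<gamma> dist_triangle[of x z y]
    by (intro set_plus_mono2 scaled_add_cone_antimono[OF K H])
      (auto simp: distrib_left[symmetric] add.commute intro: mult_left_mono)
  finally show ?thesis
    using z by (simp add: level_set_iff)
qed

text \<open>
  Here the steps are added up without the triangle inequality: the conclusion carries the whole
  length of the chain, which is what bounds that length.
\<close>
lemma level_set_chain:
  fixes f :: "'a::metric_space \<Rightarrow> 'b::real_vector set"
  assumes K: "convex_cone K" and "H \<noteq> {}" and conv: "convex (H + K)" and \<gamma>: "0 \<le> \<gamma>"
    and chain: "\<And>n. u (Suc n) \<in> level_set f S H K \<gamma> (u n)"
  shows "f (u 0) \<subseteq> f (u n) + ((*\<^sub>R) (\<gamma> * (\<Sum>k<n. dist (u k) (u (Suc k)))) ` H + K)"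
proof (induction n)
  case 0
  show ?case
    using level_set_refl[OF K \<open>H \<noteq> {}\<close>, of "u 0" UNIV f \<gamma>] by (simp add: level_set_iff)
next
  case (Suc n)
  let ?C = "\<lambda>a. (*\<^sub>R) a ` H + K"
  let ?L = "\<Sum>k<n. dist (u k) (u (Suc k))"
  note Suc.IH
  also have "f (u n) + ?C (\<gamma> * ?L)
      \<subseteq> (f (u (Suc n)) + ?C (\<gamma> * dist (u n) (u (Suc n)))) + ?C (\<gamma> * ?L)"
    using chain[of n] by (intro set_plus_mono2) (simp_all add: level_set_iff)
  also have "\<dots> = f (u (Suc n)) + (?C (\<gamma> * dist (u n) (u (Suc n))) + ?C (\<gamma> * ?L))"
    by (rule add.assoc)
  also have "\<dots> \<subseteq> f (u (Suc n)) + ?C (\<gamma> * dist (u n) (u (Suc n)) + \<gamma> * ?L)"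
    using \<gamma> by (intro set_plus_mono2[OF order_refl scaled_add_cone_plus[OF K conv]])
      (simp_all add: sum_nonneg)
  finally show ?case
    by (simp add: distrib_left add.commute)
qed

lemma lower_complete_imp_dynamically_complete:
  fixes f :: "'a::metric_space \<Rightarrow> 'b::real_vector set"
  assumes K: "convex_cone K" and H: "H \<subseteq> K" and \<gamma>: "0 \<le> \<gamma>" and "lower_complete f K"
  shows "dynamically_complete (level_set f S H K \<gamma>) x"
  unfolding dynamically_complete_def
proof (intro allI impI)
  fix u assume "Cauchy u" and chain: "\<forall>n. u (Suc n) \<in> level_set f S H K \<gamma> (u n)"
  have "f (u n) \<subseteq> f (u (Suc n)) + K" for n
  proof -
    let ?a = "\<gamma> * dist (u n) (u (Suc n))"
    have "f (u n) \<subseteq> f (u (Suc n)) + ((*\<^sub>R) ?a ` H + K)"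
      using chain by (simp add: level_set_iff)
    moreover have "(*\<^sub>R) ?a ` H + K \<subseteq> K"
      using K H \<gamma> by (auto simp: set_plus_def
          intro!: convex_cone_add_mem[OF K] convex_cone_scaleR_mem[OF K])
    ultimately show ?thesis
      by (meson order_refl order_trans set_plus_mono2)
  qed
  then show "\<exists>l. u \<longlonglongrightarrow> l"
    using \<open>lower_complete f K\<close> \<open>Cauchy u\<close> by (simp add: lower_complete_def)
qed

lemma eps_efficient_obtain_value:
  assumes "x\<^sub>0 \<in> eps_efficient f S H K \<epsilon>"
  obtains y\<^sub>0 where "y\<^sub>0 \<in> f x\<^sub>0" "\<And>x. x \<in> S \<Longrightarrow> y\<^sub>0 \<notin> f x + ((*\<^sub>R) \<epsilon> ` H + K)"
proof -
  obtain y\<^sub>0 where y0: "y\<^sub>0 \<in> f x\<^sub>0"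
    and disj: "(\<lambda>y. y - y\<^sub>0) ` (\<Union>x\<in>S. f x) \<inter> ((*\<^sub>R) (- \<epsilon>) ` H + uminus ` K) = {}"
    using assms by (auto simp: eps_efficient_def)
  have "y\<^sub>0 \<notin> f x + ((*\<^sub>R) \<epsilon> ` H + K)" if "x \<in> S" for x
  proof
    assume "y\<^sub>0 \<in> f x + ((*\<^sub>R) \<epsilon> ` H + K)"
    then obtain y h k where *: "y \<in> f x" "h \<in> H" "k \<in> K" "y\<^sub>0 = y + (\<epsilon> *\<^sub>R h + k)"
      by (auto simp: set_plus_def)
    have "y - y\<^sub>0 = (- \<epsilon>) *\<^sub>R h + - k"
      by (simp add: *(4))
    then have "y - y\<^sub>0 \<in> (*\<^sub>R) (- \<epsilon>) ` H + uminus ` K"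
      using *(2,3) by (metis imageI set_plus_intro)
    with disj that *(1) show False
      by blast
  qed
  with y0 that show thesis
    by blast
qed

section \<open>The variational principle\<close>

theorem theorem6p6:
  fixes f :: "'a::metric_space \<Rightarrow> 'b::real_vector set"
    and S :: "'a set" and K H :: "'b set"
    and x\<^sub>0 :: 'a and \<epsilon> \<gamma> :: real
  assumes "nontrivial_pointed_convex_cone K"
    and "H \<noteq> {}" and "H \<subseteq> K" and "cone_convex K H" and "0 \<notin> vcl (H + K)"
    and "S \<noteq> {}" and "closed S" and "x\<^sub>0 \<in> S" and "\<epsilon> > 0" and "\<gamma> > 0"
    and "dynamically_complete (level_set f S H K \<gamma>) x\<^sub>0 \<or> lower_complete f K"
    and "x\<^sub>0 \<in> eps_efficient f S H K \<epsilon>"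
    and "\<forall>x\<in>level_set f S H K \<gamma> x\<^sub>0. dynamically_closed (level_set f S H K \<gamma>) x"
  shows "\<exists>z\<in>S.
      f x\<^sub>0 \<subseteq> f z + (*\<^sub>R) (\<gamma> * dist x\<^sub>0 z) ` H + K
    \<and> (\<forall>x\<in>S - {z}. \<not> f z \<subseteq> f x + (*\<^sub>R) (\<gamma> * dist z x) ` H + K)
    \<and> (*\<^sub>R) (dist x\<^sub>0 z) ` H \<inter> (*\<^sub>R) (\<epsilon> / \<gamma>) ` (generated_cone (H + K) - (H + K)) \<noteq> {}"
proof -
  let ?T = "level_set f S H K \<gamma>"
  have K: "convex_cone K"
    using assms(1) by (simp add: nontrivial_pointed_convex_cone_def)
  have conv: "convex (H + K)"
    using assms(4) by (simp add: cone_convex_def)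
  have \<gamma>: "0 \<le> \<gamma>"
    using \<open>\<gamma> > 0\<close> by simp
  obtain y\<^sub>0 where y0: "y\<^sub>0 \<in> f x\<^sub>0"
    and y0_notin: "\<And>x. x \<in> S \<Longrightarrow> y\<^sub>0 \<notin> f x + ((*\<^sub>R) \<epsilon> ` H + K)"
    using eps_efficient_obtain_value[OF assms(12)] by blast
  have short: "\<gamma> * a < \<epsilon>" if "x \<in> S" "f x\<^sub>0 \<subseteq> f x + ((*\<^sub>R) (\<gamma> * a) ` H + K)" for x a
  proof (rule ccontr)
    assume "\<not> \<gamma> * a < \<epsilon>"
    then have "(*\<^sub>R) (\<gamma> * a) ` H + K \<subseteq> (*\<^sub>R) \<epsilon> ` H + K"
      using \<open>\<epsilon> > 0\<close> by (intro scaled_add_cone_antimono[OF K \<open>H \<subseteq> K\<close>]) auto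
    then have "f x + ((*\<^sub>R) (\<gamma> * a) ` H + K) \<subseteq> f x + ((*\<^sub>R) \<epsilon> ` H + K)"
      by (rule set_plus_mono2[OF order_refl])
    then show False
      using that(2) y0 y0_notin[OF that(1)] by blast
  qed
  have "\<exists>z\<in>?T x\<^sub>0. ?T z \<subseteq> {z}"
  proof (rule bounded_chains_imp_minimal)
    show "x\<^sub>0 \<in> ?T x\<^sub>0"
      by (rule level_set_refl[OF K \<open>H \<noteq> {}\<close> \<open>x\<^sub>0 \<in> S\<close>])
    show "x \<in> ?T x" if "x \<in> ?T x\<^sub>0" for x
      using that by (intro level_set_refl[OF K \<open>H \<noteq> {}\<close>]) (simp add: level_set_iff)
    show "z \<in> ?T x" if "y \<in> ?T x" "z \<in> ?T y" for x y z
      using that by (rule level_set_trans[OF K \<open>H \<subseteq> K\<close> conv \<gamma>])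
    show "(\<Sum>k<n. dist (u k) (u (Suc k))) \<le> \<epsilon> / \<gamma>"
      if "u 0 = x\<^sub>0" and chain: "\<And>n. u (Suc n) \<in> ?T (u n)" for u n
    proof -
      have "u n \<in> S"
        using that \<open>x\<^sub>0 \<in> S\<close> by (cases n) (auto simp: level_set_iff)
      then have "\<gamma> * (\<Sum>k<n. dist (u k) (u (Suc k))) < \<epsilon>"
        using level_set_chain[where u = u, OF K \<open>H \<noteq> {}\<close> conv \<gamma> chain] \<open>u 0 = x\<^sub>0\<close>
        by (intro short[of "u n"]) auto
      then show ?thesis
        using \<open>\<gamma> > 0\<close> by (simp add: pos_le_divide_eq mult.commute)
    qed
    show "dynamically_complete ?T x\<^sub>0"
      using assms(11) lower_complete_imp_dynamically_complete[OF K \<open>H \<subseteq> K\<close> \<gamma>] by blast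
    show "dynamically_closed ?T x" if "x \<in> ?T x\<^sub>0" for x
      using assms(13) that by blast
  qed
  then obtain z where z: "z \<in> S" "f x\<^sub>0 \<subseteq> f z + ((*\<^sub>R) (\<gamma> * dist x\<^sub>0 z) ` H + K)"
    and minimal: "?T z \<subseteq> {z}"
    by (auto simp: level_set_iff)
  define t where "t = \<gamma> * dist x\<^sub>0 z / \<epsilon>"
  have t: "0 \<le> t" "t < 1"
    using short[OF z] \<open>\<epsilon> > 0\<close> \<gamma> by (auto simp: t_def)
  obtain h where h: "h \<in> H" "t *\<^sub>R h \<notin> H + K"
    using contraction_leaves_add_cone[OF K \<open>H \<noteq> {}\<close> assms(5) t] by blast
  have "h \<in> H + K"
    using h(1) subset_add_cone[OF K, of H] by auto
  then have "t *\<^sub>R h \<in> generated_cone (H + K) - (H + K)"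
    using h(2) t(1) by (auto simp: generated_cone_def)
  moreover have "dist x\<^sub>0 z *\<^sub>R h = (\<epsilon> / \<gamma>) *\<^sub>R (t *\<^sub>R h)"
    using \<open>\<epsilon> > 0\<close> \<open>\<gamma> > 0\<close> by (simp add: t_def)
  ultimately have "(*\<^sub>R) (dist x\<^sub>0 z) ` H
      \<inter> (*\<^sub>R) (\<epsilon> / \<gamma>) ` (generated_cone (H + K) - (H + K)) \<noteq> {}"
    using h(1) by blast
  moreover have "\<forall>x\<in>S - {z}. \<not> f z \<subseteq> f x + (*\<^sub>R) (\<gamma> * dist z x) ` H + K"
    using minimal by (auto simp: level_set_def)
  ultimately show ?thesis
    using z by (intro bexI[of _ z]) (simp_all add: add.assoc)
qed

end
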